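(* Consider the Cauchy problem $$\partial_tu(t,\mathbf x)-\sum_{i=1}^\infty A_i(t,\mathbf x)\,\partial_{x_i}u(t,\mathbf x)-A_0(t,\mathbf x)u(t,\mathbf x)=0,\qquad u(0,\mathbf x)=\Phi(\mathbf x),\qquad(\ast)$$ where $t\in\mathbb R$, $\mathbf x=(x_i)_{i\in\mathbb N}$, and the functions $A_i$ ($i\in\mathbb N_0$) are analytic at $(0)_{i\in\mathbb N_0}$. Let $G(t,\mathbf x,\mathbf w)=\sum_{i=0}^\infty A_i(t,\mathbf x)w_i$ for $\mathbf w=(w_j)_{j\in\mathbb N_0}\in\mathbb R^{\mathbb N_0}$. Suppose that the monomial expansion of $G$ at $(0,(0)_{i\in\mathbb N},(0)_{i\in\mathbb N_0})$ is absolutely convergent at a point near $\infty$ in the topology $\mathcal T^{1/2}$, and that $\Phi\in\Xi$. Then the solution to $(\ast)$ is locally unique in the class $\Xi$: if $u_1,u_2\in\Xi$ both satisfy $(\ast)$ in a neighbourhood of $(0)_{i\in\mathbb N_0}$ in $\ell^2(\mathbb N_0)$, then $u_1=u_2$ on some neighbourhood of $(0)_{i\in\mathbb N_0}$ in $\ell^2(\mathbb N_0)$.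
   Context: $\mathbb N=\{1,2,\dots\}$, $\mathbb N_0=\mathbb N\cup\{0\}$. Points of $\ell^2(\mathbb N_0)$ (or $\mathbb R^{\mathbb N_0}$) are written $(t,(x_i)_{i\in\mathbb N})$, $t$ being the coordinate of index $0$. Analyticity: let $A$ be a countable index set and $\mathbb N_0^{(A)}$ the finitely supported families of non-negative integers; for $\mathbf x\in\mathbb R^A$, $\mathbf x^\alpha=\prod_{i}x_i^{\alpha_i}$. A real function $f$ on a set $D\subset\mathbb R^A$ is analytic at $\mathbf x_0\in D$ with monomial expansion $f(\mathbf x_0+\mathbf h)=\sum_{\alpha}c_\alpha\mathbf h^\alpha$ if there is $\mathbf v\in\mathbb R^A$ with all $v_i\ne0$ such that $\sum_\alpha|c_\alpha\mathbf v^\alpha|<\infty$ and, for every $\mathbf h$ with $|h_i|\le|v_i|$ for all $i$, $\mathbf x_0+\mathbf h\in D$ and the expansion holds. If moreover $\mathbf v$ can be chosen with $\sum_{i\in A}|v_i|^{-p}<\infty$ ($0<p<\infty$), the monomial expansion is said to be absolutely convergent at a point near $\infty$ in the topology $\mathcal T^p$. $\Xi$ is the set of real-valued functions $f$, each defined on some open neighbourhood $O$ of $(0)_{i\in\mathbb N_0}$ in $\ell^2(\mathbb N_0)$, such that $\partial_tf$ and $\partial_{x_i}f$ ($i\in\mathbb N$) exist and are continuous on $O$ (for the $\ell^2(\mathbb N_0)$ norm topology), and there is $M\in(0,\infty)$ with $|\partial_{x_i}f(\mathbf x)|\le M$ for all $\mathbf x\in O$ and $i\in\mathbb N$. A function $\Phi$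 of $\mathbf x$ only is regarded as a function of $(t,\mathbf x)$ not depending on $t$. *)

theory Defs
  imports "HOL-Analysis.Analysis" "HOL-Library.Poly_Mapping"
begin

section \<open>The Hilbert space of square-summable real sequences\<close>

definition l2 :: "(nat \<Rightarrow> real) set" where
  "l2 = {x. (\<lambda>i. (x i)\<^sup>2) summable_on UNIV}"

definition l2_dist :: "(nat \<Rightarrow> real) \<Rightarrow> (nat \<Rightarrow> real) \<Rightarrow> real" where
  "l2_dist x y = sqrt (\<Sum>\<^sub>\<infinity>i. (x i - y i)\<^sup>2)"

lemma L2_set_le_l2:
  assumes "(\<lambda>i. (x i)\<^sup>2) summable_on UNIV" "finite F"
  shows "L2_set x F \<le> sqrt (\<Sum>\<^sub>\<infinity>i. (x i)\<^sup>2)"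
  unfolding L2_set_def
  by (intro real_sqrt_le_mono finite_sum_le_infsum assms) auto

lemma l2_triangle:
  assumes x: "(\<lambda>i. (x i)\<^sup>2) summable_on UNIV" and y: "(\<lambda>i. (y i)\<^sup>2) summable_on (UNIV :: nat set)"
  shows "(\<lambda>i. (x i + y i :: real)\<^sup>2) summable_on UNIV"
    and "sqrt (\<Sum>\<^sub>\<infinity>i. (x i + y i)\<^sup>2) \<le> sqrt (\<Sum>\<^sub>\<infinity>i. (x i)\<^sup>2) + sqrt (\<Sum>\<^sub>\<infinity>i. (y i)\<^sup>2)"
proof -
  let ?C = "sqrt (\<Sum>\<^sub>\<infinity>i. (x i)\<^sup>2) + sqrt (\<Sum>\<^sub>\<infinity>i. (y i)\<^sup>2)"
  have C0: "0 \<le> ?C"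
    by (intro add_nonneg_nonneg real_sqrt_ge_zero infsum_nonneg) auto
  have bound: "(\<Sum>i\<in>F. (x i + y i)\<^sup>2) \<le> ?C\<^sup>2" if "finite F" for F
  proof -
    have "sqrt (\<Sum>i\<in>F. (x i + y i)\<^sup>2) \<le> L2_set x F + L2_set y F"
      using L2_set_triangle_ineq[of x y F] by (simp add: L2_set_def)
    also have "\<dots> \<le> ?C"
      by (intro add_mono L2_set_le_l2 x y that)
    finally show ?thesis
      by (rule sqrt_le_D)
  qed
  show s: "(\<lambda>i. (x i + y i)\<^sup>2) summable_on UNIV"
    by (rule nonneg_bdd_above_summable_on) (auto intro!: bdd_aboveI2[where M = "?C\<^sup>2"] bound)
  have "(\<Sum>\<^sub>\<infinity>i. (x i + y i)\<^sup>2) \<le> ?C\<^sup>2"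
    by (rule infsum_le_finite_sums[OF s]) (auto intro: bound)
  thus "sqrt (\<Sum>\<^sub>\<infinity>i. (x i + y i)\<^sup>2) \<le> ?C"
    using C0 by (simp add: real_le_lsqrt)
qed

lemma l2_diff_summable:
  assumes "x \<in> l2" "y \<in> l2"
  shows "(\<lambda>i. (x i - y i)\<^sup>2) summable_on UNIV"
  using l2_triangle(1)[of x "\<lambda>i. - y i"] assms by (simp add: l2_def)

interpretation l2: Metric_space l2 l2_dist
proof
  fix x y :: "nat \<Rightarrow> real"
  show "0 \<le> l2_dist x y"
    by (simp add: l2_dist_def infsum_nonneg)
  show "l2_dist x y = l2_dist y x"
    by (simp add: l2_dist_def power2_commute)
next
  fix x y assume xy: "x \<in> l2" "y \<in> l2"
  show "l2_dist x y = 0 \<longleftrightarrow> x = y"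
  proof
    assume 0: "l2_dist x y = 0"
    show "x = y"
    proof
      fix i
      have "L2_set (\<lambda>i. x i - y i) {i} \<le> l2_dist x y"
        unfolding l2_dist_def by (rule L2_set_le_l2[OF l2_diff_summable[OF xy]]) simp
      thus "x i = y i" using 0 by (simp add: L2_set_def)
    qed
  qed (simp add: l2_dist_def)
next
  fix x y z assume "x \<in> l2" "y \<in> l2" "z \<in> l2"
  thus "l2_dist x z \<le> l2_dist x y + l2_dist y z"
    using l2_triangle(2)[of "\<lambda>i. x i - y i" "\<lambda>i. y i - z i"]
    by (simp add: l2_dist_def l2_diff_summable)
qed

abbreviation l2_topology :: "(nat \<Rightarrow> real) topology" where
  "l2_topology \<equiv> l2.mtopology"

definition l2_open_nhd_0 :: "(nat \<Rightarrow> real) set \<Rightarrow> bool" where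
  "l2_open_nhd_0 U \<longleftrightarrow> openin l2_topology U \<and> (\<lambda>_. 0) \<in> U"

section \<open>Analyticity in countably many variables\<close>

text \<open>Finitely supported families of exponents are the elements of \<open>'i \<Rightarrow>\<^sub>0 nat\<close>.\<close>

definition monomial :: "('i \<Rightarrow> real) \<Rightarrow> ('i \<Rightarrow>\<^sub>0 nat) \<Rightarrow> real" where
  "monomial x \<alpha> = (\<Prod>i\<in>Poly_Mapping.keys \<alpha>. x i ^ Poly_Mapping.lookup \<alpha> i)"

text \<open>\<open>f\<close>, as a function on \<open>D\<close>, has an expansion at \<open>x\<^sub>0\<close> with coefficients \<open>c\<close> that converges
  absolutely at the increment \<open>v\<close> and represents \<open>f\<close> on the closed polydisc of polyradius \<open>v\<close>.\<close>

definition monomial_expansion ::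
    "('i::countable \<Rightarrow> real) set \<Rightarrow> (('i \<Rightarrow> real) \<Rightarrow> real) \<Rightarrow> ('i \<Rightarrow> real) \<Rightarrow>
     (('i \<Rightarrow>\<^sub>0 nat) \<Rightarrow> real) \<Rightarrow> ('i \<Rightarrow> real) \<Rightarrow> bool" where
  "monomial_expansion D f x\<^sub>0 c v \<longleftrightarrow>
     (\<forall>i. v i \<noteq> 0) \<and>
     (\<lambda>\<alpha>. \<bar>c \<alpha> * monomial v \<alpha>\<bar>) summable_on UNIV \<and>
     (\<forall>h. (\<forall>i. \<bar>h i\<bar> \<le> \<bar>v i\<bar>) \<longrightarrow>
        (\<lambda>i. x\<^sub>0 i + h i) \<in> D \<and>
        ((\<lambda>\<alpha>. c \<alpha> * monomial h \<alpha>) has_sum f (\<lambda>i. x\<^sub>0 i + h i)) UNIV)"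

definition monomially_analytic_at ::
    "('i::countable \<Rightarrow> real) set \<Rightarrow> (('i \<Rightarrow> real) \<Rightarrow> real) \<Rightarrow> ('i \<Rightarrow> real) \<Rightarrow> bool" where
  "monomially_analytic_at D f x\<^sub>0 \<longleftrightarrow> (\<exists>c v. monomial_expansion D f x\<^sub>0 c v)"

definition abs_convergent_near_infinity ::
    "real \<Rightarrow> ('i::countable \<Rightarrow> real) set \<Rightarrow> (('i \<Rightarrow> real) \<Rightarrow> real) \<Rightarrow> ('i \<Rightarrow> real) \<Rightarrow> bool" where
  "abs_convergent_near_infinity p D f x\<^sub>0 \<longleftrightarrow>
     (\<exists>c v. monomial_expansion D f x\<^sub>0 c v \<and> (\<lambda>i. \<bar>v i\<bar> powr (- p)) summable_on UNIV)"

section \<open>The class of admissible functions\<close>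

text \<open>A point \<open>(t, (x\<^sub>i)\<^sub>i\<^sub>\<ge>\<^sub>1)\<close> is a sequence \<open>z\<close> with \<open>z 0 = t\<close> and \<open>z i = x\<^sub>i\<close> for \<open>i \<ge> 1\<close>, so
  \<open>partial 0\<close> is the time derivative. On an open subset of \<open>l2\<close> the partial derivatives depend only
  on the values of the function there. Partial functions are pairs of a domain and a total
  function.\<close>

definition partial :: "nat \<Rightarrow> ((nat \<Rightarrow> real) \<Rightarrow> real) \<Rightarrow> (nat \<Rightarrow> real) \<Rightarrow> real" where
  "partial i f z = deriv (\<lambda>s. f (z(i := s))) (z i)"

definition partially_differentiable :: "nat \<Rightarrow> ((nat \<Rightarrow> real) \<Rightarrow> real) \<Rightarrow> (nat \<Rightarrow> real) \<Rightarrow> bool" where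
  "partially_differentiable i f z \<longleftrightarrow> (\<lambda>s. f (z(i := s))) field_differentiable at (z i)"

definition Xi :: "((nat \<Rightarrow> real) set \<times> ((nat \<Rightarrow> real) \<Rightarrow> real)) set" where
  "Xi = {(E, f). l2_open_nhd_0 E \<and>
     (\<forall>i. (\<forall>z\<in>E. partially_differentiable i f z) \<and>
          continuous_map (subtopology l2_topology E) euclideanreal (partial i f)) \<and>
     (\<exists>M>0. \<forall>z\<in>E. \<forall>i\<ge>1. \<bar>partial i f z\<bar> \<le> M)}"

section \<open>The Cauchy problem\<close>

text \<open>A function of \<open>x = (x\<^sub>i)\<^sub>i\<^sub>\<ge>\<^sub>1\<close> takes a sequence whose entry at position \<open>i\<close> is \<open>x\<^sub>i\<^sub>+\<^sub>1\<close>.\<close>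

definition space_part :: "(nat \<Rightarrow> real) \<Rightarrow> (nat \<Rightarrow> real)" where
  "space_part z = (\<lambda>i. z (Suc i))"

text \<open>The variables \<open>(t, x)\<close> of the generating function \<open>G\<close> are indexed by \<open>Inl\<close>, the variables
  \<open>w\<close> by \<open>Inr\<close>; the domain of \<open>G\<close> consists of all points where its defining series makes sense.\<close>

definition G_domain ::
    "(nat \<Rightarrow> (nat \<Rightarrow> real) set) \<Rightarrow> (nat \<Rightarrow> (nat \<Rightarrow> real) \<Rightarrow> real) \<Rightarrow> (nat + nat \<Rightarrow> real) set" where
  "G_domain D A = {y. (\<forall>i. (\<lambda>j. y (Inl j)) \<in> D i) \<and>
     summable (\<lambda>i. A i (\<lambda>j. y (Inl j)) * y (Inr i))}"

definition G_fun :: "(nat \<Rightarrow> (nat \<Rightarrow> real) \<Rightarrow> real) \<Rightarrow> (nat + nat \<Rightarrow> real) \<Rightarrow> real" where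
  "G_fun A y = suminf (\<lambda>i. A i (\<lambda>j. y (Inl j)) * y (Inr i))"

text \<open>\<open>u\<close>, defined on \<open>E\<close>, satisfies the Cauchy problem near the origin; the neighbourhood is taken
  inside the domains of all functions involved, \<open>P\<close> being the domain of the initial datum regarded
  as a function of \<open>(t, x)\<close>.\<close>

definition local_solution ::
    "(nat \<Rightarrow> (nat \<Rightarrow> real) set) \<Rightarrow> (nat \<Rightarrow> (nat \<Rightarrow> real) \<Rightarrow> real) \<Rightarrow>
     (nat \<Rightarrow> real) set \<Rightarrow> ((nat \<Rightarrow> real) \<Rightarrow> real) \<Rightarrow>
     (nat \<Rightarrow> real) set \<Rightarrow> ((nat \<Rightarrow> real) \<Rightarrow> real) \<Rightarrow> bool" where
  "local_solution D A P \<Phi> E u \<longleftrightarrow>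
     (\<exists>U. l2_open_nhd_0 U \<and> U \<subseteq> E \<inter> P \<inter> (\<Inter>i. D i) \<and>
        (\<forall>z\<in>U. summable (\<lambda>i. A (Suc i) z * partial (Suc i) u z) \<and>
           partial 0 u z - suminf (\<lambda>i. A (Suc i) z * partial (Suc i) u z) - A 0 z * u z = 0) \<and>
        (\<forall>z\<in>U. z 0 = 0 \<longrightarrow> u z = \<Phi> (space_part z)))"

end

theory Submission
  imports Defs
begin

text \<open>The difference \<open>w\<close> of two solutions satisfies the Haar-type inequality
  \<open>\<bar>\<partial>\<^sub>t w\<bar> \<le> (\<Sum>i. C\<^sub>i \<bar>\<partial>\<^sub>i w\<bar>) + C\<^sub>0 \<bar>w\<bar>\<close> near the origin, where \<open>\<Sum>i. C\<^sub>i < \<infinity>\<close> because the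
  expansion of \<open>G\<close> converges at a point near infinity. As the \<open>\<partial>\<^sub>i w\<close> are uniformly bounded, the
  terms with \<open>i \<ge> n\<close> contribute at most \<open>\<epsilon>\<close> for large \<open>n\<close>. Freezing these coordinates at their
  values at \<open>z\<close> leaves a compact \<open>n\<close>-dimensional cone of dependence with apex \<open>z\<close>, on which a
  maximum principle gives \<open>w z \<le> 8 \<epsilon> \<bar>t\<bar>\<close>.\<close>

section \<open>Finitely supported changes of a point of \<open>l2\<close> and first-order expansion
  along them\<close>

lemma l2_finite_change:
  assumes x: "x \<in> l2" and eq: "\<And>i. i \<ge> n \<Longrightarrow> y i = x i"
  shows "y \<in> l2" and "l2_dist x y \<le> (\<Sum>i<n. \<bar>y i - x i\<bar>)"
proof -
  have "(\<lambda>i. (y i - x i)\<^sup>2) summable_on {..<n}"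
    by simp
  moreover have "(\<lambda>i. (y i - x i)\<^sup>2) summable_on {..<n} \<longleftrightarrow> (\<lambda>i. (y i - x i)\<^sup>2) summable_on UNIV"
    by (rule summable_on_cong_neutral) (auto simp: eq)
  ultimately have "(\<lambda>i. (x i + (y i - x i))\<^sup>2) summable_on UNIV"
    using x by (intro l2_triangle(1)) (auto simp: l2_def)
  then show "y \<in> l2"
    by (simp add: l2_def)
  have "(\<Sum>\<^sub>\<infinity>i. (x i - y i)\<^sup>2) = (\<Sum>\<^sub>\<infinity>i\<in>{..<n}. (x i - y i)\<^sup>2)"
    by (rule infsum_cong_neutral) (auto simp: eq)
  then have "l2_dist x y = L2_set (\<lambda>i. x i - y i) {..<n}"
    by (simp add: l2_dist_def L2_set_def)
  also have "\<dots> \<le> (\<Sum>i<n. \<bar>x i - y i\<bar>)"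
    by (rule L2_set_le_sum_abs)
  finally show "l2_dist x y \<le> (\<Sum>i<n. \<bar>y i - x i\<bar>)"
    by (simp add: abs_minus_commute)
qed

lemma l2_coordinate_le:
  assumes "x \<in> l2" "y \<in> l2"
  shows "\<bar>x i - y i\<bar> \<le> l2_dist x y"
  using L2_set_le_l2[OF l2_diff_summable[OF assms], of "{i}"]
  by (simp add: l2_dist_def L2_set_def)

lemma continuous_on_l2_openD:
  assumes "openin l2_topology S" "y \<in> S"
    and g: "continuous_map (subtopology l2_topology S) euclideanreal g" and "e > 0"
  obtains d where "d > 0" "l2.mball y d \<subseteq> S" "\<And>y'. y' \<in> l2.mball y d \<Longrightarrow> \<bar>g y' - g y\<bar> < e"
proof -
  have "openin (subtopology l2_topology S) {x \<in> topspace (subtopology l2_topology S). g x \<in> ball (g y) e}"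
    by (rule openin_continuous_map_preimage[OF g]) simp
  moreover have "topspace (subtopology l2_topology S) = S"
    using assms(1) by (metis openin_subset topspace_subtopology_subset)
  ultimately have "openin l2_topology {x \<in> S. g x \<in> ball (g y) e}"
    using assms(1) by (simp only: openin_open_subtopology)
  moreover have "y \<in> {x \<in> S. g x \<in> ball (g y) e}"
    using assms by simp
  ultimately obtain d where "d > 0" "l2.mball y d \<subseteq> {x \<in> S. g x \<in> ball (g y) e}"
    unfolding l2.openin_mtopology by blast
  then show ?thesis
    by (intro that[of d]) (auto simp: subset_iff dist_real_def abs_minus_commute)
qed

text \<open>This is the classical argument that continuous partial derivatives give
  differentiability: change one coordinate at a time, use the mean value inequality on each edge and
  telescope. Increments live on the first \<open>n\<close> coordinates, so the finite l1 sum
  measures them and dominates the \<open>l2\<close> distance.\<close>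

lemma first_order_increment:
  assumes S: "openin l2_topology S" and y: "y \<in> S"
    and diff: "\<And>i x. i < n \<Longrightarrow> x \<in> S \<Longrightarrow> partially_differentiable i f x"
    and cont: "\<And>i. i < n \<Longrightarrow> continuous_map (subtopology l2_topology S) euclideanreal (partial i f)"
    and e: "e > 0"
  shows "\<exists>d>0. \<forall>h. (\<forall>i\<ge>n. h i = 0) \<longrightarrow> (\<Sum>i<n. \<bar>h i\<bar>) < d \<longrightarrow>
    \<bar>f (\<lambda>i. y i + h i) - f y - (\<Sum>i<n. partial i f y * h i)\<bar> \<le> e * (\<Sum>i<n. \<bar>h i\<bar>)"
proof -
  have "\<exists>d>0. \<forall>y'\<in>l2.mball y d. y' \<in> S \<and> \<bar>partial i f y' - partial i f y\<bar> < e" if "i < n" for i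
    by (rule continuous_on_l2_openD[OF S y cont[OF that] e]) blast
  then obtain d where d: "\<And>i. i < n \<Longrightarrow> d i > 0"
    "\<And>i y'. i < n \<Longrightarrow> y' \<in> l2.mball y (d i) \<Longrightarrow> y' \<in> S \<and> \<bar>partial i f y' - partial i f y\<bar> < e"
    by metis
  \<comment> \<open>The extra entry 1 keeps the minimum defined and positive when
    \<open>n = 0\<close>.\<close>
  define \<delta> where "\<delta> = Min (insert 1 (d ` {..<n}))"
  have \<delta>: "\<delta> > 0" "\<And>i. i < n \<Longrightarrow> \<delta> \<le> d i"
    using d(1) by (auto simp: \<delta>_def)
  have yl2: "y \<in> l2"
    using S y openin_subset by fastforce
  show ?thesis
  proof (intro exI[of _ \<delta>] conjI allI impI \<delta>(1))
    fix h :: "nat \<Rightarrow> real"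
    assume h0: "\<forall>i\<ge>n. h i = 0" and h\<delta>: "(\<Sum>i<n. \<bar>h i\<bar>) < \<delta>"
    \<comment> \<open>The points \<open>q 0, ..., q n\<close> are the vertices of a path from
      \<open>y\<close> to \<open>y + h\<close> whose \<open>k\<close>-th edge is parallel to the
      \<open>k\<close>-th coordinate axis.\<close>
    define q where "q k = (\<lambda>i. if i < k then y i + h i else y i)" for k
    have step: "\<bar>f (q (Suc k)) - f (q k) - partial k f y * h k\<bar> \<le> e * \<bar>h k\<bar>" if k: "k < n" for k
    proof -
      define T where "T = closed_segment (y k) (y k + h k)"
      have T: "\<bar>s - y k\<bar> \<le> \<bar>h k\<bar>" if "s \<in> T" for s
        using that by (auto simp: T_def closed_segment_eq_real_ivl split: if_splits)
      have inS: "(q k)(k := s) \<in> S" "\<bar>partial k f ((q k)(k := s)) - partial k f y\<bar> < e" if "s \<in> T" for s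
      proof -
        have l: "((q k)(k := s)) i = y i" if "i \<ge> n" for i
          using that k by (auto simp: q_def)
        have "l2_dist y ((q k)(k := s)) \<le> (\<Sum>i<n. \<bar>((q k)(k := s)) i - y i\<bar>)"
          by (rule l2_finite_change(2)[OF yl2 l])
        also have "\<dots> \<le> (\<Sum>i<n. \<bar>h i\<bar>)"
          using T[OF \<open>s \<in> T\<close>] by (intro sum_mono) (auto simp: q_def)
        also have "\<dots> < d k"
          using h\<delta> \<delta>(2)[OF k] by simp
        finally have "(q k)(k := s) \<in> l2.mball y (d k)"
          using l2_finite_change(1)[OF yl2, of n "(q k)(k := s)"] l yl2 by (simp only: l2.in_mball)
        then show "(q k)(k := s) \<in> S" "\<bar>partial k f ((q k)(k := s)) - partial k f y\<bar> < e"
          using d(2)[OF k] by blast+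
      qed
      \<comment> \<open>Subtracting the linear part with slope frozen at \<open>y\<close> leaves a
        derivative smaller than \<open>e\<close> along the whole edge.\<close>
      define G where "G s = f ((q k)(k := s)) - partial k f y * s" for s
      have "norm (G (y k + h k) - G (y k)) \<le> e * norm ((y k + h k) - y k)"
      proof (rule field_differentiable_bound[where S = T and
            f' = "\<lambda>s. partial k f ((q k)(k := s)) - partial k f y"])
        show "(G has_field_derivative (partial k f ((q k)(k := s)) - partial k f y)) (at s within T)"
          if s: "s \<in> T" for s
        proof -
          have "partially_differentiable k f ((q k)(k := s))"
            using diff[OF k inS(1)[OF s]] .
          then have "((\<lambda>s. f ((q k)(k := s))) has_field_derivative partial k f ((q k)(k := s))) (at s)"
            by (simp add: partially_differentiable_def partial_def DERIV_deriv_iff_field_differentiable)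
          then have "(G has_field_derivative (partial k f ((q k)(k := s)) - partial k f y)) (at s)"
            unfolding G_def by (auto intro!: derivative_eq_intros)
          then show ?thesis
            by (rule has_field_derivative_at_within)
        qed
        show "norm (partial k f ((q k)(k := s)) - partial k f y) \<le> e" if "s \<in> T" for s
          using inS(2)[OF that] by simp
      qed (auto simp: T_def)
      moreover have "(q k)(k := y k + h k) = q (Suc k)" "(q k)(k := y k) = q k"
        by (auto simp: q_def fun_eq_iff)
      ultimately show ?thesis
        by (simp add: G_def algebra_simps)
    qed
    have "q n = (\<lambda>i. y i + h i)" "q 0 = y"
      using h0 by (auto simp: q_def fun_eq_iff)
    then have "f (\<lambda>i. y i + h i) - f y = (\<Sum>k<n. f (q (Suc k)) - f (q k))"
      using sum_lessThan_telescope[of "\<lambda>k. f (q k)" n] by simp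
    then have "\<bar>f (\<lambda>i. y i + h i) - f y - (\<Sum>i<n. partial i f y * h i)\<bar>
        = \<bar>\<Sum>k<n. f (q (Suc k)) - f (q k) - partial k f y * h k\<bar>"
      by (simp add: sum_subtractf)
    also have "\<dots> \<le> (\<Sum>k<n. e * \<bar>h k\<bar>)"
      by (rule order_trans[OF sum_abs]) (auto intro: sum_mono step)
    finally show "\<bar>f (\<lambda>i. y i + h i) - f y - (\<Sum>i<n. partial i f y * h i)\<bar> \<le> e * (\<Sum>i<n. \<bar>h i\<bar>)"
      by (simp add: sum_distrib_left)
  qed
qed

section \<open>The maximum principle on the cone of dependence\<close>

text \<open>If \<open>f z\<close> were too large, a weighted and tilted copy \<open>W\<close> of
  \<open>f\<close> would have a positive maximum on the cone with apex \<open>z\<close>. The maximum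
  cannot lie at time 0, where \<open>f\<close> vanishes, and a short step towards time 0 inside the
  cone would increase \<open>W\<close> further.\<close>

lemma haar_bound:
  fixes f :: "(nat \<Rightarrow> real) \<Rightarrow> real" and C :: "nat \<Rightarrow> real"
  assumes S: "openin l2_topology S" and zS: "z \<in> S" and RS: "l2.mball z R \<subseteq> S"
    and n: "n \<ge> 1" and \<epsilon>: "\<epsilon> > 0"
    and diff: "\<And>i x. i < n \<Longrightarrow> x \<in> S \<Longrightarrow> partially_differentiable i f x"
    and cont: "\<And>i. i < n \<Longrightarrow> continuous_map (subtopology l2_topology S) euclideanreal (partial i f)"
    and C: "\<And>i. C i \<ge> 0"
    and R: "\<bar>z 0\<bar> * (1 + (\<Sum>i=1..<n. C i)) < R" and small: "4 * C 0 * \<bar>z 0\<bar> \<le> 1"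
    and ineq: "\<And>y. y \<in> S \<Longrightarrow>
      \<bar>partial 0 f y\<bar> \<le> (\<Sum>i=1..<n. C i * \<bar>partial i f y\<bar>) + C 0 * \<bar>f y\<bar> + \<epsilon>"
    and init: "\<And>y. y \<in> S \<Longrightarrow> y 0 = 0 \<Longrightarrow> f y = 0"
  shows "f z \<le> 8 * \<epsilon> * \<bar>z 0\<bar>"
proof (rule ccontr)
  assume neg: "\<not> f z \<le> 8 * \<epsilon> * \<bar>z 0\<bar>"
  \<comment> \<open>The sign \<open>\<sigma>\<close> treats both time directions at once:
    \<open>\<sigma> * y 0\<close> is the elapsed time, running from 0 to \<open>t\<close>.\<close>
  define \<sigma> :: real where "\<sigma> = (if z 0 < 0 then -1 else 1)"
  define t where "t = \<bar>z 0\<bar>"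
  have \<sigma>z: "\<sigma> * z 0 = t" and \<sigma>1: "\<bar>\<sigma>\<bar> = 1" "\<sigma> * \<sigma> = 1" and t0: "t \<ge> 0"
    by (auto simp: \<sigma>_def t_def)
  have split: "(\<Sum>i<n. a i) = a 0 + (\<Sum>i=1..<n. a i)" for a :: "nat \<Rightarrow> real"
    using n by (simp add: sum.atLeast_Suc_lessThan lessThan_atLeast0)
  have zl2: "z \<in> l2"
    using S zS openin_subset by fastforce
  \<comment> \<open>Half-widths of a box around \<open>z\<close> containing the cone; the value 0
    for \<open>i \<ge> n\<close> freezes the remaining coordinates.\<close>
  define b where "b i = (if i = 0 then t else if i < n then C i * t else 0)" for i
  \<comment> \<open>The cone has its apex at elapsed time \<open>t\<close> and widens at rate
    \<open>C i\<close> in coordinate \<open>i\<close> as the elapsed time decreases to 0.\<close>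
  define L where "L = {y. 0 \<le> \<sigma> * y 0 \<and> \<sigma> * y 0 \<le> t \<and> (\<forall>i\<in>{1..<n}. \<bar>y i - z i\<bar> \<le> C i * (t - \<sigma> * y 0))}"
  define K where "K = {y. \<forall>i. \<bar>y i - z i\<bar> \<le> b i} \<inter> L"
  have K_I: "y \<in> K" if "\<And>i. i \<ge> n \<Longrightarrow> y i = z i" "y \<in> L" for y
  proof -
    have "\<bar>y i - z i\<bar> \<le> b i" for i
    proof -
      consider "i = 0" | "1 \<le> i" "i < n" | "n \<le> i" "i \<noteq> 0"
        by linarith
      then show ?thesis
      proof cases
        case 1
        have "\<bar>y 0 - z 0\<bar> \<le> t"
          using that(2) by (auto simp: L_def \<sigma>_def t_def split: if_splits)
        then show ?thesis
          by (simp add: 1 b_def)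
      next
        case 2
        then have "\<bar>y i - z i\<bar> \<le> C i * (t - \<sigma> * y 0)"
          using that(2) by (auto simp: L_def)
        also have "\<dots> \<le> C i * t"
          using that(2) by (intro mult_left_mono C) (auto simp: L_def)
        finally show ?thesis
          using 2 by (simp add: b_def)
      next
        case 3
        then show ?thesis
          by (simp add: b_def that(1))
      qed
    qed
    then show ?thesis
      using that(2) by (simp add: K_def)
  qed
  have K_far: "y i = z i" if "y \<in> K" "i \<ge> n" for y i
  proof -
    have "\<bar>y i - z i\<bar> \<le> b i"
      using that(1) by (simp add: K_def)
    then show ?thesis
      using that(2) n by (simp add: b_def)
  qed
  have KS: "K \<subseteq> S"
  proof
    fix y assume y: "y \<in> K"
    have "l2_dist z y \<le> (\<Sum>i<n. \<bar>y i - z i\<bar>)"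
      by (rule l2_finite_change(2)[OF zl2 K_far[OF y]])
    also have "\<dots> \<le> (\<Sum>i<n. b i)"
      using y by (intro sum_mono) (simp add: K_def)
    also have "\<dots> = t * (1 + (\<Sum>i=1..<n. C i))"
      by (simp add: split b_def distrib_left sum_distrib_left mult.commute)
    also have "\<dots> < R"
      using R by (simp add: t_def)
    finally have "y \<in> l2.mball z R"
      using l2_finite_change(1)[OF zl2 K_far[OF y]] zl2 by (simp only: l2.in_mball)
    then show "y \<in> S"
      using RS by blast
  qed
  have zK: "z \<in> K"
    using t0 by (intro K_I) (auto simp: L_def \<sigma>z)
  have coord: "continuous_on UNIV (\<lambda>y :: nat \<Rightarrow> real. y i)" for i
    by simp
  \<comment> \<open>Compactness refers to the product topology of the function type: the box is
    compact by Tychonoff, and \<open>L\<close> is cut out by finitely many closed conditions on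
    coordinates.\<close>
  have "compact K"
  proof -
    have "{y :: nat \<Rightarrow> real. \<forall>i. \<bar>y i - z i\<bar> \<le> b i} = Pi\<^sub>E UNIV (\<lambda>i. cball (z i) (b i))"
      by (auto simp: dist_real_def abs_minus_commute PiE_def Pi_def)
    moreover have "compactin (product_topology (\<lambda>_. euclidean) UNIV) (Pi\<^sub>E UNIV (\<lambda>i. cball (z i) (b i)))"
      by (simp add: compactin_PiE)
    ultimately have box: "compact {y :: nat \<Rightarrow> real. \<forall>i. \<bar>y i - z i\<bar> \<le> b i}"
      by (simp add: euclidean_product_topology)
    have "L = {y. 0 \<le> \<sigma> * y 0} \<inter> {y. \<sigma> * y 0 \<le> t} \<inter>
        (\<Inter>i\<in>{1..<n}. {y. \<bar>y i - z i\<bar> \<le> C i * (t - \<sigma> * y 0)})"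
      by (auto simp: L_def)
    moreover have "closed \<dots>"
      by (intro closed_Int closed_INT ballI closed_Collect_le continuous_intros coord)
    ultimately show ?thesis
      using box by (simp add: K_def compact_Int_closed)
  qed
  \<comment> \<open>Continuity is needed for the product topology, while the derivatives are
    continuous for the \<open>l2\<close> metric. Points of \<open>K\<close> differ only in the first
    \<open>n\<close> coordinates, where coordinatewise convergence makes the l1 sum tend to
    0.\<close>
  moreover have contf: "continuous_on K f"
    unfolding continuous_on_def
  proof
    fix y assume y: "y \<in> K"
    have "\<exists>d>0. \<forall>h. (\<forall>i\<ge>n. h i = 0) \<longrightarrow> (\<Sum>i<n. \<bar>h i\<bar>) < d \<longrightarrow>
      \<bar>f (\<lambda>i. y i + h i) - f y - (\<Sum>i<n. partial i f y * h i)\<bar> \<le> 1 * (\<Sum>i<n. \<bar>h i\<bar>)"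
      using y KS by (intro first_order_increment[OF S _ diff cont]) auto
    then obtain d where d: "d > 0"
      and inc: "\<And>h. (\<And>i. i \<ge> n \<Longrightarrow> h i = 0) \<Longrightarrow> (\<Sum>i<n. \<bar>h i\<bar>) < d \<Longrightarrow>
      \<bar>f (\<lambda>i. y i + h i) - f y - (\<Sum>i<n. partial i f y * h i)\<bar> \<le> (\<Sum>i<n. \<bar>h i\<bar>)"
      by auto
    have lim_i: "((\<lambda>y'. y' i) \<longlongrightarrow> y i) (at y within K)" for i
      using coord[of i] continuous_on_subset[OF coord[of i], of K] y by (auto simp: continuous_on_def)
    have lim: "((\<lambda>y'. \<Sum>i<n. c i * \<bar>y' i - y i\<bar>) \<longlongrightarrow> 0) (at y within K)" for c :: "nat \<Rightarrow> real"
    proof -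
      have "((\<lambda>y'. \<Sum>i<n. c i * \<bar>y' i - y i\<bar>) \<longlongrightarrow> (\<Sum>i<n. c i * \<bar>y i - y i\<bar>)) (at y within K)"
        by (intro tendsto_intros lim_i)
      then show ?thesis
        by simp
    qed
    have "eventually (\<lambda>y'. (\<Sum>i<n. 1 * \<bar>y' i - y i\<bar>) < d) (at y within K)"
      using order_tendstoD(2)[OF lim d] .
    moreover have "eventually (\<lambda>y'. y' \<in> K) (at y within K)"
      by (simp add: eventually_at_topological) blast
    ultimately have "eventually (\<lambda>y'. norm (f y' - f y) \<le> (\<Sum>i<n. (\<bar>partial i f y\<bar> + 1) * \<bar>y' i - y i\<bar>)) (at y within K)"
    proof eventually_elim
      case (elim y')
      have far: "y' i - y i = 0" if "i \<ge> n" for i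
        using K_far[OF y that] K_far[OF elim(2) that] by simp
      have "\<bar>f (\<lambda>i. y i + (y' i - y i)) - f y - (\<Sum>i<n. partial i f y * (y' i - y i))\<bar> \<le> (\<Sum>i<n. \<bar>y' i - y i\<bar>)"
        by (rule inc[OF far]) (use elim(1) in simp_all)
      moreover have "\<bar>\<Sum>i<n. partial i f y * (y' i - y i)\<bar> \<le> (\<Sum>i<n. \<bar>partial i f y\<bar> * \<bar>y' i - y i\<bar>)"
        by (rule order_trans[OF sum_abs]) (simp add: abs_mult)
      ultimately show ?case
        by (simp add: distrib_right sum.distrib)
    qed
    then have "((\<lambda>y'. f y' - f y) \<longlongrightarrow> 0) (at y within K)"
      using lim by (rule Lim_null_comparison)
    then show "(f \<longlongrightarrow> f y) (at y within K)"
      by (simp add: LIM_zero_iff)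
  qed
  \<comment> \<open>The weight \<open>g\<close> decreases in elapsed time in order to absorb the
    zero-order term \<open>C 0 * \<bar>f y\<bar>\<close>; the smallness of \<open>t\<close> keeps it
    between 1/2 and 1.\<close>
  define g where "g s = 1 - 2 * C 0 * s" for s :: real
  \<comment> \<open>The tilt by \<open>4 * \<epsilon>\<close> absorbs the error terms. As
    \<open>g\<close> is at least 1/2, the assumed excess over \<open>8 * \<epsilon> * t\<close>
    still makes \<open>W z\<close> positive.\<close>
  define W where "W y = g (\<sigma> * y 0) * f y - 4 * \<epsilon> * (\<sigma> * y 0)" for y
  have "continuous_on K W"
    unfolding W_def g_def by (intro continuous_intros contf continuous_on_subset[OF coord]) auto
  ultimately obtain y where y: "y \<in> K" and max: "\<And>y'. y' \<in> K \<Longrightarrow> W y' \<le> W y"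
    using continuous_attains_sup[of K W] zK by blast
  have g: "1 / 2 \<le> g s" "g s \<le> 1" if "0 \<le> s" "s \<le> t" for s
  proof -
    have "4 * C 0 * s \<le> 4 * C 0 * t"
      using that C[of 0] by (intro mult_left_mono) auto
    then show "1 / 2 \<le> g s"
      using small by (simp add: g_def t_def)
    show "g s \<le> 1"
      using that C[of 0] by (simp add: g_def)
  qed
  have "W y > 0"
  proof -
    have fz: "8 * \<epsilon> * t < f z"
      using neg by (simp add: t_def)
    then have "0 \<le> f z"
      using \<epsilon> t0 by (smt (verit) mult_nonneg_nonneg)
    then have "1 / 2 * f z \<le> g t * f z"
      using g[of t] t0 by (intro mult_right_mono) auto
    then have "W z > 0"
      using fz by (simp add: W_def \<sigma>z)
    then show ?thesis
      using max[OF zK] by simp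
  qed
  define s where "s = \<sigma> * y 0"
  have s: "0 \<le> s" "s \<le> t" and yL: "\<And>i. i \<in> {1..<n} \<Longrightarrow> \<bar>y i - z i\<bar> \<le> C i * (t - s)"
    using y by (auto simp: K_def L_def s_def)
  have y0: "y 0 = \<sigma> * s"
    using \<sigma>1 by (simp add: s_def flip: mult.assoc)
  \<comment> \<open>Positivity removes the absolute value from the zero-order term of
    \<open>ineq\<close> and, by \<open>init\<close>, excludes elapsed time 0.\<close>
  have "f y > 0"
  proof -
    have "0 < g s * f y"
      using \<open>W y > 0\<close> \<epsilon> s by (smt (verit) W_def s_def mult_nonneg_nonneg)
    then show ?thesis
      using g[OF s] by (simp add: zero_less_mult_iff)
  qed
  have "s > 0"
  proof (rule ccontr)
    assume "\<not> s > 0"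
    then have "f y = 0"
      using s y0 y KS by (intro init) auto
    with \<open>f y > 0\<close> show False by simp
  qed
  \<comment> \<open>\<open>Q\<close> bounds the l1 length of a step per unit of time, so precision
    \<open>\<epsilon> / Q\<close> gives a total error of at most \<open>\<epsilon>\<close> times the
    duration.\<close>
  define Q where "Q = 1 + (\<Sum>i=1..<n. C i)"
  have Q: "Q \<ge> 1"
    by (simp add: Q_def sum_nonneg C)
  have "\<exists>d>0. \<forall>h. (\<forall>i\<ge>n. h i = 0) \<longrightarrow> (\<Sum>i<n. \<bar>h i\<bar>) < d \<longrightarrow>
      \<bar>f (\<lambda>i. y i + h i) - f y - (\<Sum>i<n. partial i f y * h i)\<bar> \<le> (\<epsilon> / Q) * (\<Sum>i<n. \<bar>h i\<bar>)"
    using y KS \<epsilon> Q by (intro first_order_increment[OF S _ diff cont]) auto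
  then obtain d where d: "d > 0"
    and inc: "\<And>h. (\<And>i. i \<ge> n \<Longrightarrow> h i = 0) \<Longrightarrow> (\<Sum>i<n. \<bar>h i\<bar>) < d \<Longrightarrow>
      \<bar>f (\<lambda>i. y i + h i) - f y - (\<Sum>i<n. partial i f y * h i)\<bar> \<le> (\<epsilon> / Q) * (\<Sum>i<n. \<bar>h i\<bar>)"
    by auto
  \<comment> \<open>The bound by \<open>s\<close> keeps the step from passing time 0; the factor 2
    makes its l1 length strictly less than \<open>d\<close>.\<close>
  define h where "h = min s (d / (2 * Q))"
  have h: "h > 0" "h \<le> s"
    using \<open>s > 0\<close> d Q by (auto simp: h_def)
  have hQ: "h * Q < d"
  proof -
    have "h * Q \<le> d / (2 * Q) * Q"
      using Q by (intro mult_right_mono) (auto simp: h_def)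
    then show ?thesis
      using d Q by simp
  qed
  define p where "p i = partial i f y" for i
  \<comment> \<open>From the maximum point, a step towards \<open>t = 0\<close> along the edge of the cone on which the first-order
    change of \<open>f\<close> is largest; it stays in the cone since the cone widens at rate \<open>C i\<close>.\<close>
  define \<eta> where "\<eta> i = (if i = 0 then - \<sigma> * h else if i < n then h * C i * sgn (p i) else 0)" for i
  have sum_\<eta>: "(\<Sum>i<n. \<bar>\<eta> i\<bar>) \<le> h * Q"
  proof -
    have "(\<Sum>i=1..<n. \<bar>\<eta> i\<bar>) \<le> (\<Sum>i=1..<n. h * C i)"
      using h C by (intro sum_mono) (auto simp: \<eta>_def abs_mult abs_sgn_eq)
    moreover have "\<bar>\<eta> 0\<bar> = h"
      using h \<sigma>1 by (simp add: \<eta>_def abs_mult)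
    ultimately show ?thesis
      by (simp add: split Q_def distrib_left sum_distrib_left)
  qed
  define y' where "y' = (\<lambda>i. y i + \<eta> i)"
  have y'0: "\<sigma> * y' 0 = s - h"
    using \<sigma>1 by (simp add: y'_def \<eta>_def s_def algebra_simps)
  have "y' \<in> K"
  proof (rule K_I)
    show "y' i = z i" if "i \<ge> n" for i
      using that n K_far[OF y that] by (simp add: y'_def \<eta>_def)
    have "\<bar>y' i - z i\<bar> \<le> C i * (t - (s - h))" if i: "i \<in> {1..<n}" for i
    proof -
      have "\<bar>y' i - z i\<bar> \<le> \<bar>y i - z i\<bar> + \<bar>\<eta> i\<bar>"
        by (simp add: y'_def)
      also have "\<bar>\<eta> i\<bar> \<le> h * C i"
        using h C[of i] i by (auto simp: \<eta>_def abs_mult abs_sgn_eq)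
      finally show ?thesis
        using yL[OF i] by (simp add: algebra_simps)
    qed
    then show "y' \<in> L"
      using h s by (auto simp: L_def y'0)
  qed
  \<comment> \<open>\<open>a\<close> bounds the rate at which \<open>f\<close> can drop along the
    step: \<open>C 0 * f y + \<epsilon>\<close> comes from the differential inequality and another
    \<open>\<epsilon>\<close> from the first-order error.\<close>
  define a where "a = C 0 * f y + 2 * \<epsilon>"
  have a: "a > 0"
    using C[of 0] \<open>f y > 0\<close> \<epsilon> by (simp add: a_def add_nonneg_pos)
  have fy': "f y' \<ge> f y - h * a"
  proof -
    have "\<bar>f y' - f y - (\<Sum>i<n. p i * \<eta> i)\<bar> \<le> (\<epsilon> / Q) * (\<Sum>i<n. \<bar>\<eta> i\<bar>)"
      unfolding y'_def p_def
      by (rule inc) (use n sum_\<eta> hQ in \<open>auto simp: \<eta>_def\<close>)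
    also have "\<dots> \<le> (\<epsilon> / Q) * (h * Q)"
      using sum_\<eta> \<epsilon> Q by (intro mult_left_mono) auto
    also have "\<dots> = \<epsilon> * h"
      using Q by simp
    finally have 1: "f y' \<ge> f y + (\<Sum>i<n. p i * \<eta> i) - \<epsilon> * h"
      by linarith
    \<comment> \<open>The signs \<open>sgn (p i)\<close> make the spatial gain equal to
      \<open>h\<close> times the derivative sum in the bound for \<open>\<bar>p 0\<bar>\<close>, so
      the spatial terms cancel.\<close>
    have "(\<Sum>i=1..<n. p i * \<eta> i) = h * (\<Sum>i=1..<n. C i * \<bar>p i\<bar>)"
      unfolding sum_distrib_left
      by (intro sum.cong refl) (auto simp: \<eta>_def abs_sgn mult_ac)
    then have 2: "(\<Sum>i<n. p i * \<eta> i) = h * ((\<Sum>i=1..<n. C i * \<bar>p i\<bar>) - \<sigma> * p 0)"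
      by (simp add: split \<eta>_def algebra_simps)
    have "\<sigma> * p 0 \<le> \<bar>p 0\<bar>"
      using \<sigma>1 abs_ge_self[of "\<sigma> * p 0"] by (simp add: abs_mult)
    also have "\<bar>p 0\<bar> \<le> (\<Sum>i=1..<n. C i * \<bar>p i\<bar>) + C 0 * f y + \<epsilon>"
      using ineq[of y] y KS \<open>f y > 0\<close> by (auto simp: p_def)
    finally have "h * ((\<Sum>i=1..<n. C i * \<bar>p i\<bar>) - \<sigma> * p 0) \<ge> h * (- (C 0 * f y + \<epsilon>))"
      using h by (intro mult_left_mono) auto
    then show ?thesis
      using 1 2 by (simp add: a_def algebra_simps)
  qed
  have gs: "g (s - h) = g s + 2 * C 0 * h"
    by (simp add: g_def algebra_simps)
  have gb: "1 / 2 \<le> g (s - h)" "g (s - h) \<le> 1"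
    using g[of "s - h"] h s by auto
  have "g (s - h) * (f y - h * a) \<le> g (s - h) * f y'"
    using fy' gb by (intro mult_left_mono) auto
  also have "\<dots> \<le> g s * f y - 4 * \<epsilon> * h"
    using max[OF \<open>y' \<in> K\<close>] by (simp add: W_def y'0 s_def[symmetric] algebra_simps)
  \<comment> \<open>The slope \<open>2 * C 0\<close> of the weight and the tilt
    \<open>4 * \<epsilon>\<close> are chosen so that together they gain exactly
    \<open>h * (2 * a)\<close>, whereas the drop of \<open>f\<close> costs at most
    \<open>h * a\<close>.\<close>
  finally have "h * (2 * a) \<le> h * (g (s - h) * a)"
    by (simp add: a_def gs algebra_simps)
  then have "2 * a \<le> g (s - h) * a"
    using h by simp
  also have "\<dots> \<le> 1 * a"
    using gb a by (intro mult_right_mono) auto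
  finally show False
    using a by simp
qed

section \<open>Summable bounds for the coefficients \<open>A i\<close>\<close>

lemma abs_monomial_mono:
  assumes "\<And>i. \<bar>x i\<bar> \<le> \<bar>y i\<bar>"
  shows "\<bar>monomial x \<alpha>\<bar> \<le> \<bar>monomial y \<alpha>\<bar>"
  unfolding monomial_def abs_prod power_abs using assms by (intro prod_mono) (simp add: power_mono)

text \<open>Evaluating \<open>G\<close> with a single nonzero \<open>w\<close>-variable, set to the
  matching entry of \<open>v\<close>, isolates one \<open>A i\<close>. The absolute sum at
  \<open>v\<close> bounds this value, so \<open>A i\<close> is at most that sum divided by
  \<open>\<bar>v (Inr i)\<bar>\<close>.\<close>

lemma generating_function_coefficient_bound:
  assumes "abs_convergent_near_infinity p (G_domain D A) (G_fun A) (\<lambda>_. 0)" and p: "0 < p" "p \<le> 1"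
  obtains C \<delta> where "\<delta> > 0" "\<And>i. C i \<ge> 0" "summable C"
    "\<And>z i. \<forall>j. \<bar>z j\<bar> \<le> \<delta> \<Longrightarrow> \<bar>A i z\<bar> \<le> C i"
proof -
  obtain c v where exp: "monomial_expansion (G_domain D A) (G_fun A) (\<lambda>_. 0) c v"
    and vsum: "(\<lambda>k. \<bar>v k\<bar> powr (- p)) summable_on UNIV"
    using assms by (auto simp: abs_convergent_near_infinity_def)
  have v0: "v k \<noteq> 0" for k
    using exp by (simp add: monomial_expansion_def)
  have csum: "(\<lambda>\<alpha>. \<bar>c \<alpha> * monomial v \<alpha>\<bar>) summable_on UNIV"
    using exp by (simp add: monomial_expansion_def)
  \<comment> \<open>Each \<open>b k\<close> is at most the total \<open>T\<close>, which gives all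
    \<open>\<bar>v k\<bar>\<close> the common positive lower bound \<open>T powr (-1 / p)\<close>;
    this serves as \<open>\<delta>\<close>.\<close>
  define b where "b k = \<bar>v k\<bar> powr (- p)" for k
  define T where "T = infsum b UNIV"
  have bT: "b k \<le> T" for k
    using finite_sum_le_infsum[OF vsum, of "{k}"] by (simp add: b_def[abs_def] T_def)
  have b0: "b k > 0" for k
    using v0 by (simp add: b_def)
  have T0: "T > 0"
    using b0 bT by (rule less_le_trans)
  have vb: "b k powr (-1 / p) = \<bar>v k\<bar>" "b k powr (1 / p) = 1 / \<bar>v k\<bar>" for k
  proof -
    have "b k powr (-1 / p) = \<bar>v k\<bar> powr 1" "b k powr (1 / p) = \<bar>v k\<bar> powr (-1)"
      unfolding b_def powr_powr using p by simp_all
    then show "b k powr (-1 / p) = \<bar>v k\<bar>" "b k powr (1 / p) = 1 / \<bar>v k\<bar>"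
      using v0[of k] by (simp_all add: powr_minus_divide)
  qed
  define S where "S = (\<Sum>\<^sub>\<infinity>\<alpha>. \<bar>c \<alpha> * monomial v \<alpha>\<bar>)"
  have S0: "S \<ge> 0"
    unfolding S_def by (rule infsum_nonneg) simp
  show ?thesis
  proof
    show "T powr (-1 / p) > 0"
      using T0 by simp
    show "S / \<bar>v (Inr i)\<bar> \<ge> 0" for i
      using S0 by simp
    have "(\<lambda>i. b (Inr i)) summable_on UNIV"
      using summable_on_subset_banach[OF vsum, of "range Inr"]
      by (simp add: summable_on_reindex o_def b_def)
    then have "summable (\<lambda>i. b (Inr i) * (T powr (1 / p - 1) * S))"
      by (intro summable_mult2 summable_on_imp_summable)
    then show "summable (\<lambda>i. S / \<bar>v (Inr i)\<bar>)"
    proof (rule summable_comparison_test'[where N = 0])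
      fix i :: nat
      \<comment> \<open>One factor \<open>b (Inr i)\<close> is split off for summability; the
        remaining exponent \<open>1 / p - 1\<close> is nonnegative because \<open>p \<le> 1\<close>,
        so that power is bounded through \<open>T\<close>.\<close>
      have "1 / \<bar>v (Inr i)\<bar> = b (Inr i) powr (1 + (1 / p - 1))"
        by (simp add: vb)
      also have "\<dots> = b (Inr i) * b (Inr i) powr (1 / p - 1)"
        using b0 by (simp only: powr_add powr_one order_less_imp_le)
      also have "\<dots> \<le> b (Inr i) * T powr (1 / p - 1)"
        using p b0[of "Inr i"] bT[of "Inr i"] by (intro mult_left_mono powr_mono2) auto
      finally show "norm (S / \<bar>v (Inr i)\<bar>) \<le> b (Inr i) * (T powr (1 / p - 1) * S)"
        using mult_right_mono[OF _ S0] S0 by (fastforce simp: mult_ac)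
    qed
    fix z :: "nat \<Rightarrow> real" and i
    assume z: "\<forall>j. \<bar>z j\<bar> \<le> T powr (-1 / p)"
    \<comment> \<open>The test point lies in the polydisc of \<open>v\<close>: its
      \<open>Inl\<close> entries are at most \<open>\<delta>\<close>, and its only possibly nonzero
      \<open>Inr\<close> entry is that of \<open>v\<close>.\<close>
    define h where "h = case_sum z (\<lambda>j. if j = i then v (Inr i) else 0)"
    have hv: "\<bar>h k\<bar> \<le> \<bar>v k\<bar>" for k
    proof (cases k)
      case (Inl j)
      have "T powr (-1 / p) \<le> b k powr (-1 / p)"
        using p bT b0 by (intro powr_mono2') auto
      then show ?thesis
        using spec[OF z, of j] by (simp add: Inl h_def vb(1)[of "Inl j", simplified])
    qed (auto simp: h_def)
    then have "((\<lambda>\<alpha>. c \<alpha> * monomial h \<alpha>) has_sum G_fun A h) UNIV"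
      using exp by (simp add: monomial_expansion_def)
    then have "norm (G_fun A h) \<le> S"
      unfolding S_def
    proof (rule norm_infsum_le[OF _ has_sum_infsum[OF csum]])
      show "norm (c \<alpha> * monomial h \<alpha>) \<le> \<bar>c \<alpha> * monomial v \<alpha>\<bar>" for \<alpha>
        using abs_monomial_mono[of h v] hv by (simp add: abs_mult mult_left_mono)
    qed
    moreover have "G_fun A h = A i z * v (Inr i)"
    proof -
      have "(\<lambda>j. A j z * (if j = i then v (Inr i) else 0)) sums (A i z * v (Inr i))"
        using sums_single[of i "\<lambda>j. A j z * v (Inr i)"] by (simp add: if_distrib cong: if_cong)
      then show ?thesis
        by (simp add: G_fun_def h_def sums_iff)
    qed
    ultimately show "\<bar>A i z\<bar> \<le> S / \<bar>v (Inr i)\<bar>"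
      using v0 by (simp add: abs_mult pos_le_divide_eq)
  qed
qed

section \<open>The difference of two solutions and local comparison\<close>

lemma partial_diff:
  assumes "partially_differentiable i f z" "partially_differentiable i g z"
  shows "partially_differentiable i (\<lambda>z. f z - g z) z"
    and "partial i (\<lambda>z. f z - g z) z = partial i f z - partial i g z"
  using assms unfolding partially_differentiable_def partial_def
  by (auto intro: field_differentiable_diff deriv_diff)

lemma Xi_diff:
  assumes "(E, f) \<in> Xi" "(F, g) \<in> Xi"
  shows "(E \<inter> F, \<lambda>z. f z - g z) \<in> Xi"
proof -
  obtain M N where M: "M > 0" "\<And>z i. z \<in> E \<Longrightarrow> i \<ge> 1 \<Longrightarrow> \<bar>partial i f z\<bar> \<le> M"
    and N: "N > 0" "\<And>z i. z \<in> F \<Longrightarrow> i \<ge> 1 \<Longrightarrow> \<bar>partial i g z\<bar> \<le> N"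
    using assms by (auto simp: Xi_def)
  have pd: "partially_differentiable i f z" "partially_differentiable i g z" if "z \<in> E \<inter> F" for z i
    using assms that by (auto simp: Xi_def)
  have "l2_open_nhd_0 (E \<inter> F)"
    using assms by (auto simp: Xi_def l2_open_nhd_0_def intro: openin_Int)
  moreover have "continuous_map (subtopology l2_topology (E \<inter> F)) euclideanreal (partial i (\<lambda>z. f z - g z))" for i
  proof (rule continuous_map_eq)
    show "continuous_map (subtopology l2_topology (E \<inter> F)) euclideanreal (\<lambda>z. partial i f z - partial i g z)"
      using assms by (intro continuous_map_diff)
        (auto simp: Xi_def intro: continuous_map_from_subtopology_mono)
  qed (simp add: partial_diff pd)
  moreover have "\<bar>partial i (\<lambda>z. f z - g z) z\<bar> \<le> M + N" if "z \<in> E \<inter> F" "i \<ge> 1" for z i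
    using M(2)[of z i] N(2)[of z i] that by (simp add: partial_diff pd)
  ultimately show ?thesis
    using M(1) N(1) by (auto simp: Xi_def partial_diff pd intro!: exI[of _ "M + N"])
qed

lemma local_solutionE:
  assumes "local_solution D A P \<Phi> E u"
  obtains U where "l2_open_nhd_0 U" "U \<subseteq> E"
    "\<And>z. z \<in> U \<Longrightarrow> summable (\<lambda>i. A (Suc i) z * partial (Suc i) u z)"
    "\<And>z. z \<in> U \<Longrightarrow>
      partial 0 u z = suminf (\<lambda>i. A (Suc i) z * partial (Suc i) u z) + A 0 z * u z"
    "\<And>z. z \<in> U \<Longrightarrow> z 0 = 0 \<Longrightarrow> u z = \<Phi> (space_part z)"
proof -
  from assms obtain U where U: "l2_open_nhd_0 U" "U \<subseteq> E \<inter> P \<inter> (\<Inter>i. D i)"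
    and eq: "\<forall>z\<in>U. summable (\<lambda>i. A (Suc i) z * partial (Suc i) u z) \<and>
      partial 0 u z - suminf (\<lambda>i. A (Suc i) z * partial (Suc i) u z) - A 0 z * u z = 0"
    and init: "\<forall>z\<in>U. z 0 = 0 \<longrightarrow> u z = \<Phi> (space_part z)"
    unfolding local_solution_def by (elim exE conjE)
  show ?thesis
  proof (rule that[OF U(1)])
    fix z assume z: "z \<in> U"
    show "partial 0 u z = suminf (\<lambda>i. A (Suc i) z * partial (Suc i) u z) + A 0 z * u z"
      using bspec[OF eq z] by simp
  qed (use U(2) eq init in auto)
qed

text \<open>The difference \<open>w\<close> has zero initial data and satisfies the Haar-type
  inequality on a fixed ball for every \<open>\<epsilon> > 0\<close>. The smaller ball on which
  \<open>haar_bound\<close> is applied does not depend on \<open>\<epsilon>\<close>, so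
  \<open>\<epsilon>\<close> can tend to 0 at each of its points.\<close>

lemma local_comparison:
  assumes G: "abs_convergent_near_infinity p (G_domain D A) (G_fun A) (\<lambda>_. 0)" "0 < p" "p \<le> 1"
    and Xi: "(E\<^sub>1, u\<^sub>1) \<in> Xi" "(E\<^sub>2, u\<^sub>2) \<in> Xi"
    and sol: "local_solution D A P \<Phi> E\<^sub>1 u\<^sub>1" "local_solution D A P \<Phi> E\<^sub>2 u\<^sub>2"
  shows "\<exists>W. l2_open_nhd_0 W \<and> W \<subseteq> E\<^sub>1 \<inter> E\<^sub>2 \<and> (\<forall>z\<in>W. u\<^sub>1 z \<le> u\<^sub>2 z)"
proof -
  define w where "w z = u\<^sub>1 z - u\<^sub>2 z" for z
  have w: "(E\<^sub>1 \<inter> E\<^sub>2, w) \<in> Xi"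
    using Xi_diff[OF Xi] by (simp add: w_def[abs_def])
  then obtain M where M: "M > 0" "\<And>z i. z \<in> E\<^sub>1 \<inter> E\<^sub>2 \<Longrightarrow> i \<ge> 1 \<Longrightarrow> \<bar>partial i w z\<bar> \<le> M"
    by (auto simp: Xi_def)
  obtain C \<delta> where \<delta>: "\<delta> > 0" and C: "\<And>i. C i \<ge> 0" "summable C"
    and AC: "\<And>z i. \<forall>j. \<bar>z j\<bar> \<le> \<delta> \<Longrightarrow> \<bar>A i z\<bar> \<le> C i"
    by (rule generating_function_coefficient_bound[OF G]) (rule that)
  obtain U\<^sub>1 where U1: "l2_open_nhd_0 U\<^sub>1" "U\<^sub>1 \<subseteq> E\<^sub>1"
    "\<And>z. z \<in> U\<^sub>1 \<Longrightarrow> summable (\<lambda>i. A (Suc i) z * partial (Suc i) u\<^sub>1 z)"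
    "\<And>z. z \<in> U\<^sub>1 \<Longrightarrow>
      partial 0 u\<^sub>1 z = suminf (\<lambda>i. A (Suc i) z * partial (Suc i) u\<^sub>1 z) + A 0 z * u\<^sub>1 z"
    "\<And>z. z \<in> U\<^sub>1 \<Longrightarrow> z 0 = 0 \<Longrightarrow> u\<^sub>1 z = \<Phi> (space_part z)"
    by (rule local_solutionE[OF sol(1)]) (rule that)
  obtain U\<^sub>2 where U2: "l2_open_nhd_0 U\<^sub>2" "U\<^sub>2 \<subseteq> E\<^sub>2"
    "\<And>z. z \<in> U\<^sub>2 \<Longrightarrow> summable (\<lambda>i. A (Suc i) z * partial (Suc i) u\<^sub>2 z)"
    "\<And>z. z \<in> U\<^sub>2 \<Longrightarrow>
      partial 0 u\<^sub>2 z = suminf (\<lambda>i. A (Suc i) z * partial (Suc i) u\<^sub>2 z) + A 0 z * u\<^sub>2 z"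
    "\<And>z. z \<in> U\<^sub>2 \<Longrightarrow> z 0 = 0 \<Longrightarrow> u\<^sub>2 z = \<Phi> (space_part z)"
    by (rule local_solutionE[OF sol(2)]) (rule that)
  have "openin l2_topology (U\<^sub>1 \<inter> U\<^sub>2)" and O: "(\<lambda>_. 0) \<in> U\<^sub>1 \<inter> U\<^sub>2"
    using U1(1) U2(1) by (auto simp: l2_open_nhd_0_def)
  then obtain r where r: "r > 0" "l2.mball (\<lambda>_. 0) r \<subseteq> U\<^sub>1 \<inter> U\<^sub>2"
    unfolding l2.openin_mtopology by blast
  have Ol2: "(\<lambda>_. 0) \<in> l2"
    by (simp add: l2_def)
  \<comment> \<open>The \<open>l2\<close> norm dominates every coordinate, so a radius at most
    \<open>\<delta>\<close> makes the bounds \<open>C i\<close> available on the whole ball.\<close>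
  define R where "R = min r \<delta>"
  define S where "S = l2.mball (\<lambda>_. 0) R"
  have R: "R > 0" "R \<le> \<delta>" and SU: "S \<subseteq> U\<^sub>1" "S \<subseteq> U\<^sub>2"
    using r \<delta> l2.mball_subset_concentric[of R r "\<lambda>_. 0"] by (auto simp: R_def S_def)
  have SE: "S \<subseteq> E\<^sub>1 \<inter> E\<^sub>2"
    using SU U1(2) U2(2) by blast
  have Sopen: "openin l2_topology S"
    by (simp add: S_def)
  have Scoord: "\<bar>y i\<bar> < R" if "y \<in> S" for y i
    using l2_coordinate_le[OF Ol2, of y i] that by (simp add: S_def)
  have AS: "\<bar>A i y\<bar> \<le> C i" if "y \<in> S" for y i
  proof (rule AC)
    show "\<forall>j. \<bar>y j\<bar> \<le> \<delta>"
      using Scoord[OF that] R(2) by (meson less_le_trans less_imp_le)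
  qed
  have wdiff: "partially_differentiable i w y" if "y \<in> S" for i y
    using w SE that by (auto simp: Xi_def)
  have wcont: "continuous_map (subtopology l2_topology S) euclideanreal (partial i w)" for i
    using w SE by (auto simp: Xi_def intro: continuous_map_from_subtopology_mono)
  have wbound: "\<bar>partial (Suc i) w y\<bar> \<le> M" if "y \<in> S" for i y
    using M(2)[of y "Suc i"] SE that by auto
  have weq: "partial 0 w y = suminf (\<lambda>i. A (Suc i) y * partial (Suc i) w y) + A 0 y * w y" if y: "y \<in> S" for y
  proof -
    have yU: "y \<in> U\<^sub>1" "y \<in> U\<^sub>2"
      using SU y by auto
    have pw: "partial i w y = partial i u\<^sub>1 y - partial i u\<^sub>2 y" for i
      unfolding w_def using Xi U1(2) U2(2) yU by (intro partial_diff) (auto simp: Xi_def)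
    have "suminf (\<lambda>i. A (Suc i) y * partial (Suc i) w y) =
        suminf (\<lambda>i. A (Suc i) y * partial (Suc i) u\<^sub>1 y) - suminf (\<lambda>i. A (Suc i) y * partial (Suc i) u\<^sub>2 y)"
      using suminf_diff[OF U1(3)[OF yU(1)] U2(3)[OF yU(2)]] by (simp add: pw right_diff_distrib)
    then show ?thesis
      using U1(4)[OF yU(1)] U2(4)[OF yU(2)] by (simp add: pw w_def right_diff_distrib)
  qed
  have winit: "w y = 0" if "y \<in> S" "y 0 = 0" for y
    using U1(5)[OF subsetD[OF SU(1) that(1)] that(2)] U2(5)[OF subsetD[OF SU(2) that(1)] that(2)]
    by (simp add: w_def)
  \<comment> \<open>The uniform bound \<open>M\<close> on the spatial derivatives turns summability
    of \<open>C\<close> into a tail estimate, with \<open>n\<close> depending on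
    \<open>\<epsilon>\<close> but not on \<open>y\<close>.\<close>
  have wineq: "\<exists>n\<ge>1. \<forall>y\<in>S.
      \<bar>partial 0 w y\<bar> \<le> (\<Sum>i=1..<n. C i * \<bar>partial i w y\<bar>) + C 0 * \<bar>w y\<bar> + \<epsilon>" if \<epsilon>: "\<epsilon> > 0" for \<epsilon>
  proof -
    have C': "summable (\<lambda>i. C (Suc i) * M)"
      using C(2) by (intro summable_mult2) (simp add: summable_Suc_iff)
    obtain n where n: "\<And>m. m \<ge> n \<Longrightarrow> norm (suminf (\<lambda>i. C (Suc (i + m)) * M)) < \<epsilon>"
      using suminf_exist_split[OF \<epsilon> C'] by blast
    \<comment> \<open>Term \<open>i\<close> of the series belongs to coordinate
      \<open>Suc i\<close>, so the first \<open>n\<close> terms are coordinates 1 to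
      \<open>n\<close>; the bound \<open>Suc n\<close> also ensures the \<open>n \<ge> 1\<close> of
      \<open>haar_bound\<close>.\<close>
    have "\<bar>partial 0 w y\<bar> \<le> (\<Sum>i=1..<Suc n. C i * \<bar>partial i w y\<bar>) + C 0 * \<bar>w y\<bar> + \<epsilon>" if y: "y \<in> S" for y
    proof -
      define a where "a i = A (Suc i) y * partial (Suc i) w y" for i
      have a: "\<bar>a i\<bar> \<le> C (Suc i) * M" for i
        unfolding a_def abs_mult using AS[OF y] wbound[OF y] C(1) by (intro mult_mono) auto
      have "summable (\<lambda>i. \<bar>a i\<bar>)"
        by (rule summable_comparison_test'[OF C', of 0]) (simp add: a)
      then have tail: "summable (\<lambda>i. \<bar>a (i + n)\<bar>)" and suma: "summable a"
        by (simp_all add: summable_rabs_cancel summable_ignore_initial_segment[where f = "\<lambda>i. \<bar>a i\<bar>"])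
      have "\<bar>suminf (\<lambda>i. a (i + n))\<bar> \<le> suminf (\<lambda>i. \<bar>a (i + n)\<bar>)"
        by (rule summable_rabs[OF tail])
      also have "\<dots> \<le> suminf (\<lambda>i. C (Suc (i + n)) * M)"
        using summable_ignore_initial_segment[OF C', of n] by (intro suminf_le tail) (simp_all add: a)
      also have "\<dots> \<le> \<epsilon>"
        using n[of n] by simp
      finally have 1: "\<bar>suminf (\<lambda>i. a (i + n))\<bar> \<le> \<epsilon>" .
      have "\<bar>\<Sum>i<n. a i\<bar> \<le> (\<Sum>i<n. C (Suc i) * \<bar>partial (Suc i) w y\<bar>)"
        using AS[OF y] by (intro order_trans[OF sum_abs] sum_mono) (simp add: a_def abs_mult mult_right_mono)
      also have "\<dots> = (\<Sum>i=1..<Suc n. C i * \<bar>partial i w y\<bar>)"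
        by (simp only: sum.atLeast_Suc_lessThan_Suc_shift One_nat_def lessThan_atLeast0 o_def)
      finally have 2: "\<bar>\<Sum>i<n. a i\<bar> \<le> \<dots>" .
      have 3: "\<bar>A 0 y * w y\<bar> \<le> C 0 * \<bar>w y\<bar>"
        using AS[OF y] by (simp add: abs_mult mult_right_mono)
      have "partial 0 w y = suminf (\<lambda>i. a (i + n)) + (\<Sum>i<n. a i) + A 0 y * w y"
        using weq[OF y] suminf_split_initial_segment[OF suma, of n] by (simp add: a_def[abs_def])
      then show ?thesis
        using 1 2 3 by linarith
    qed
    then show ?thesis
      by (intro exI[of _ "Suc n"]) auto
  qed
  define T where "T = suminf C"
  have T: "T \<ge> 0" "\<And>n. (\<Sum>i=1..<n. C i) \<le> T"
    using C by (auto simp: T_def intro: suminf_nonneg sum_le_suminf)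
  \<comment> \<open>The cone at \<open>z\<close> has l1 radius at most
    \<open>\<rho> * (1 + T)\<close> for every \<open>n\<close>, and \<open>z\<close> is closer than
    \<open>\<rho>\<close> to the origin, so \<open>3 + T\<close> leaves room inside radius
    \<open>R\<close>. The second bound yields
    \<open>4 * C 0 * \<bar>z 0\<bar> \<le> 1\<close>.\<close>
  define \<rho> where "\<rho> = min (R / (3 + T)) (1 / (4 * C 0 + 1))"
  have \<rho>: "\<rho> > 0" "\<rho> * (3 + T) \<le> R" "\<rho> * (4 * C 0 + 1) \<le> 1"
  proof -
    have "0 < 3 + T" "0 < 4 * C 0 + 1"
      using T(1) C(1)[of 0] by simp_all
    moreover have "\<rho> \<le> R / (3 + T)" "\<rho> \<le> 1 / (4 * C 0 + 1)"
      by (simp_all add: \<rho>_def)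
    ultimately show "\<rho> > 0" "\<rho> * (3 + T) \<le> R" "\<rho> * (4 * C 0 + 1) \<le> 1"
      using R(1) by (simp_all only: pos_le_divide_eq) (simp add: \<rho>_def)
  qed
  have \<rho>R: "\<rho> \<le> R"
    using \<rho>(1,2) mult_left_mono[of 1 "3 + T" \<rho>] T(1) by linarith
  have small: "w z \<le> 0" if z: "z \<in> l2.mball (\<lambda>_. 0) \<rho>" for z
  proof -
    define q where "q = l2_dist (\<lambda>_. 0) z"
    have zl2: "z \<in> l2" and q: "q < \<rho>" "\<bar>z 0\<bar> \<le> q"
      using z l2_coordinate_le[OF Ol2, of z 0] by (auto simp: q_def)
    have zS: "z \<in> S"
      using q \<rho>R zl2 Ol2 by (simp add: S_def q_def)
    have ball: "l2.mball z (R - q) \<subseteq> S"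
      using l2.triangle[OF Ol2 zl2] Ol2 by (fastforce simp: S_def q_def)
    have C0z: "4 * C 0 * \<bar>z 0\<bar> \<le> 1"
    proof -
      have "\<bar>z 0\<bar> * (4 * C 0) \<le> \<rho> * (4 * C 0)"
        using q C(1)[of 0] by (intro mult_right_mono) auto
      then show ?thesis
        using \<rho>(1,3) by (simp add: algebra_simps)
    qed
    have cone: "\<bar>z 0\<bar> * (1 + (\<Sum>i=1..<n. C i)) < R - q" for n
    proof -
      have "\<bar>z 0\<bar> * (1 + (\<Sum>i=1..<n. C i)) \<le> \<rho> * (1 + T)"
        using q T(2)[of n] C(1) by (intro mult_mono) (auto intro!: add_nonneg_nonneg sum_nonneg)
      then show ?thesis
        using \<rho>(1,2) q by (simp add: algebra_simps)
    qed
    have bound: "w z \<le> 8 * \<epsilon> * \<bar>z 0\<bar>" if \<epsilon>: "\<epsilon> > 0" for \<epsilon>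
    proof -
      obtain n where "n \<ge> 1" "\<And>y. y \<in> S \<Longrightarrow>
          \<bar>partial 0 w y\<bar> \<le> (\<Sum>i=1..<n. C i * \<bar>partial i w y\<bar>) + C 0 * \<bar>w y\<bar> + \<epsilon>"
        using wineq[OF \<epsilon>] by blast
      then show ?thesis
        by (intro haar_bound[OF Sopen zS ball _ \<epsilon> wdiff wcont C(1) cone C0z _ winit]) auto
    qed
    show ?thesis
    proof (rule field_le_epsilon)
      fix e :: real assume e: "e > 0"
      \<comment> \<open>The added 1 keeps the denominator positive when
        \<open>z 0 = 0\<close>.\<close>
      have "w z \<le> 8 * (e / (8 * (\<bar>z 0\<bar> + 1))) * \<bar>z 0\<bar>"
        using e by (intro bound) (simp add: add_nonneg_pos)
      also have "\<dots> = e * (\<bar>z 0\<bar> / (\<bar>z 0\<bar> + 1))"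
        by (simp add: field_simps)
      also have "\<dots> \<le> e * 1"
        using e by (intro mult_left_mono) auto
      finally show "w z \<le> 0 + e" by simp
    qed
  qed
  have "l2.mball (\<lambda>_. 0) \<rho> \<subseteq> S"
    using \<rho>R unfolding S_def by (rule l2.mball_subset_concentric)
  then show ?thesis
    using small SE \<rho>(1) Ol2
    by (intro exI[of _ "l2.mball (\<lambda>_. 0) \<rho>"]) (auto simp: l2_open_nhd_0_def w_def)
qed

theorem theorem142:
  fixes D :: "nat \<Rightarrow> (nat \<Rightarrow> real) set"
    and A :: "nat \<Rightarrow> (nat \<Rightarrow> real) \<Rightarrow> real"
    and P E\<^sub>1 E\<^sub>2 :: "(nat \<Rightarrow> real) set"
    and \<Phi> u\<^sub>1 u\<^sub>2 :: "(nat \<Rightarrow> real) \<Rightarrow> real"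
  assumes "\<And>i. monomially_analytic_at (D i) (A i) (\<lambda>_. 0)"
    and "abs_convergent_near_infinity (1 / 2) (G_domain D A) (G_fun A) (\<lambda>_. 0)"
    and "(P, \<lambda>z. \<Phi> (space_part z)) \<in> Xi"
    and "(E\<^sub>1, u\<^sub>1) \<in> Xi" and "local_solution D A P \<Phi> E\<^sub>1 u\<^sub>1"
    and "(E\<^sub>2, u\<^sub>2) \<in> Xi" and "local_solution D A P \<Phi> E\<^sub>2 u\<^sub>2"
  shows "\<exists>W. l2_open_nhd_0 W \<and> W \<subseteq> E\<^sub>1 \<inter> E\<^sub>2 \<and> (\<forall>z\<in>W. u\<^sub>1 z = u\<^sub>2 z)"
proof -
  \<comment> \<open>The hypotheses are symmetric in the two solutions, so comparing them in both
    orders gives equality on the intersection.\<close>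
  obtain V where "l2_open_nhd_0 V" "V \<subseteq> E\<^sub>1 \<inter> E\<^sub>2" "\<forall>z\<in>V. u\<^sub>1 z \<le> u\<^sub>2 z"
    using local_comparison[OF assms(2) _ _ assms(4,6,5,7)] by auto
  moreover obtain W where "l2_open_nhd_0 W" "\<forall>z\<in>W. u\<^sub>2 z \<le> u\<^sub>1 z"
    using local_comparison[OF assms(2) _ _ assms(6,4,7,5)] by auto
  ultimately show ?thesis
    by (intro exI[of _ "V \<inter> W"]) (auto simp: l2_open_nhd_0_def intro: openin_Int antisym)
qed

end
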